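(* Define sequences $(a_n),(b_n),(c_n),(d_n)$, $n\ge 0$, by the power series expansions $$\frac{(q^8, q^{22} ;q^{30})_\infty}{(q^7, q^{23}; q^{30})_\infty}= \sum_{n=0}^{\infty}a_n q^n,\qquad \frac{(q^4, q^{26};q^{30})_\infty}{(q^{11}, q^{19}; q^{30})_\infty}= \sum_{n=0}^{\infty}b_n q^n,$$ $$\frac{(q^2, q^{28};q^{30})_\infty}{(q^{13}, q^{17}; q^{30})_\infty}= \sum_{n=0}^{\infty}c_n q^n,\qquad \frac{(q^{14}, q^{16} ;q^{30})_\infty}{(q, q^{29}; q^{30})_\infty}= \sum_{n=0}^{\infty}d_n q^n.$$ Then for every integer $n\ge 0$: (i) $a_{15n+2}=0$; (ii) $b_{15n+9}=0$; (iii) $c_{15n+14}=0$; (iv) $d_{15n+14}=0$.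
   Context: For $|q|<1$, $(\lambda;q)_\infty=\prod_{j=0}^{\infty}(1-\lambda q^j)$, and $(\lambda_1,\lambda_2;q)_\infty=(\lambda_1;q)_\infty(\lambda_2;q)_\infty$; for example $(q^8,q^{22};q^{30})_\infty=\prod_{j\ge 0}(1-q^{8+30j})(1-q^{22+30j})$. The products may be read as formal power series in $q$ or as analytic functions on $|q|<1$. *)

theory Defs
  imports "HOL-Analysis.Analysis"
begin

definition qpoch_inf :: "complex \<Rightarrow> complex \<Rightarrow> complex" where
  "qpoch_inf l q = (\<Prod>j. 1 - l * q ^ j)"

definition qpoch_inf2 :: "complex \<Rightarrow> complex \<Rightarrow> complex \<Rightarrow> complex" where
  "qpoch_inf2 l1 l2 q = qpoch_inf l1 q * qpoch_inf l2 q"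

end

theory Submission
  imports Defs "HOL-Number_Theory.Cong" "HOL-Complex_Analysis.Cauchy_Integral_Formula"
begin

text \<open>
  In all four quotients the parameters have the form \<open>q\<close> to the powers \<open>15 - b\<close> and \<open>15 + b\<close> over \<open>q\<close> to
  the powers \<open>b\<close> and \<open>30 - b\<close>, with \<open>b = 7, 11, 13, 1\<close>. In terms of \<open>p = q\<^sup>1\<^sup>5\<close>, \<open>z = q\<^sup>b\<close> and the theta
  product \<open>\<theta>(z) = (z, p\<^sup>2 / z; p\<^sup>2)\<^sub>\<infinity>\<close>, the quotient is \<open>\<theta>(p z) / \<theta>(z)\<close>. Such a quotient
  is, up to a factor \<open>T(p)\<close> that does not depend on \<open>z\<close>, a bilateral Lambert series:

    \<open>T(p) \<theta>(p z) / \<theta>(z) = \<Sum>n\<in>\<int>. z\<^sup>n / (1 - p\<^sup>2\<^sup>n\<^sup>+\<^sup>1)\<close>   for \<open>\<bar>p\<bar>\<^sup>2 < \<bar>z\<bar> < 1\<close>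

  (theorem \<open>lambert_series_eq_theta_quotient\<close>, proved with the help of the Jacobi triple product).

  As \<open>T(p)\<close> and the denominators contain only powers of \<open>q\<^sup>1\<^sup>5\<close>, the exponents of \<open>q\<close> that are congruent to \<open>r\<close>
  modulo \<open>15\<close> come from those \<open>n\<close> with \<open>b n \<equiv> r\<close>, that is, from a single residue class \<open>n = 15 m + n0\<close>.
  For the four residues \<open>r\<close> of the theorem, \<open>2 n0 + 1 = 30 - b\<close>, and this part of the series is, up to a
  power of \<open>q\<close>,

    \<open>\<Sum>m\<in>\<int>. p\<^sup>b\<^sup>m / (1 - w (p\<^sup>b w)\<^sup>m)\<close>   with \<open>w\<close> the power of \<open>p\<close> with exponent \<open>30 - b\<close>.

  The half with \<open>m \<ge> 0\<close> is symmetric in \<open>p\<^sup>b\<close> and \<open>w\<close>, as its geometric expansion shows, and the half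
  with \<open>m < 0\<close> is the same series with these two interchanged and the opposite sign. So the sum is
  zero (lemma \<open>bilateral_lambert_series_zero\<close>), and as \<open>T(p) \<noteq> 0\<close> for \<open>0 < p < 1\<close>, the corresponding
  coefficients of the quotient vanish. The argument works for any modulus \<open>M\<close> coprime to \<open>b\<close>
  in the place of \<open>15\<close> (theorem \<open>theta_quotient_coefficients_vanish\<close>).
\<close>

section \<open>Sums over the integers\<close>

lemma has_sum_int_split:
  fixes f :: "int \<Rightarrow> 'a :: {topological_comm_monoid_add, t2_space}"
  assumes "((\<lambda>m. f (int m)) has_sum A) UNIV"
      and "((\<lambda>m. f (- 1 - int m)) has_sum B) UNIV"
  shows "(f has_sum (A + B)) UNIV"
proof -
  have "(f has_sum A) {0..}"
    using assms(1)
    by (subst has_sum_reindex_bij_witness[where i = int and j = nat and T = UNIV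
          and h = "\<lambda>m. f (int m)" and s' = A]) auto
  moreover have "(f has_sum B) {..<0}"
    using assms(2)
    by (subst has_sum_reindex_bij_witness[where i = "\<lambda>m. - 1 - int m" and j = "\<lambda>n. nat (- 1 - n)"
          and T = UNIV and h = "\<lambda>m. f (- 1 - int m)" and s' = B]) auto
  moreover have "{0..} \<union> {..<0} = (UNIV :: int set)"
    by auto
  ultimately show ?thesis
    using has_sum_Un_disjoint[of f "{0..}" A "{..<0}" B] by (auto simp: disjoint_iff)
qed

lemma abs_summable_int_split:
  fixes f :: "int \<Rightarrow> 'a :: banach"
  assumes "summable (\<lambda>m. norm (f (int m)))" and "summable (\<lambda>m. norm (f (- 1 - int m)))"
  shows "(\<lambda>n. norm (f n)) summable_on UNIV"
proof -
  have "(\<lambda>m. norm (f (int m))) summable_on UNIV" "(\<lambda>m. norm (f (- 1 - int m))) summable_on UNIV"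
    using assms by (auto intro!: norm_summable_imp_summable_on)
  then obtain A B where "((\<lambda>m. norm (f (int m))) has_sum A) UNIV"
      "((\<lambda>m. norm (f (- 1 - int m))) has_sum B) UNIV"
    unfolding summable_on_def by blast
  from has_sum_int_split[OF this] show ?thesis
    by (rule has_sum_imp_summable)
qed

text \<open>
  Pairing the index \<open>m\<close> with \<open>-1 - m\<close> turns a sum over the integers into an ordinary series. This is
  how Tannery's theorem and positivity of series, both of which concern sequences, get applied to
  bilateral sums.
\<close>
lemma has_sum_int_imp_sums_paired:
  fixes f :: "int \<Rightarrow> 'a :: banach"
  assumes "(f has_sum S) UNIV"
  shows "(\<lambda>m. f (int m) + f (- 1 - int m)) sums S"
proof -
  have sub: "f summable_on X" for X
    using assms summable_on_subset_banach[of f UNIV X] has_sum_imp_summable by blast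
  have "f summable_on range int"  "f summable_on range (\<lambda>m. - 1 - int m)"
    by (rule sub)+
  then have "(f \<circ> int) summable_on UNIV" "(f \<circ> (\<lambda>m. - 1 - int m)) summable_on UNIV"
    using summable_on_reindex[of int UNIV f] summable_on_reindex[of "\<lambda>m. - 1 - int m" UNIV f]
    by (auto simp: inj_on_def)
  then obtain A B where A: "((\<lambda>m. f (int m)) has_sum A) UNIV"
      and B: "((\<lambda>m. f (- 1 - int m)) has_sum B) UNIV"
    unfolding summable_on_def o_def by blast
  have "A + B = S"
    using has_sum_int_split[OF A B] assms has_sum_unique by blast
  then show ?thesis
    using sums_add[OF has_sum_imp_sums[OF A] has_sum_imp_sums[OF B]] by simp
qed

lemma has_sum_finite_sum:
  fixes f :: "'i \<Rightarrow> 'a \<Rightarrow> 'b :: topological_comm_monoid_add"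
  assumes "finite I" "\<And>i. i \<in> I \<Longrightarrow> (f i has_sum S i) A"
  shows "((\<lambda>x. \<Sum>i\<in>I. f i x) has_sum (\<Sum>i\<in>I. S i)) A"
  using assms by (induction I rule: finite_induct) (auto intro: has_sum_add)

section \<open>The Jacobi triple product\<close>

text \<open>
  The terms of the Jacobi theta series, with nome \<open>p\<close> in the place of \<open>u = p\<^sup>2\<close>: the usual weight
  \<open>u\<close> to the power \<open>k (k - 1) / 2\<close> becomes \<open>p\<close> to the power \<open>k (k - 1)\<close>, and half-integral powers
  of \<open>u\<close>, which occur when \<open>z\<close> is replaced by \<open>p z\<close>, never have to be written.
\<close>
definition theta_term :: "complex \<Rightarrow> complex \<Rightarrow> int \<Rightarrow> complex" where
  "theta_term p z k = (-1) powi k * p powi (k * (k - 1)) * z powi k"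

definition qfac :: "complex \<Rightarrow> nat \<Rightarrow> complex" where
  "qfac u n = (\<Prod>i<n. 1 - u ^ Suc i)"

text \<open>
  The reciprocal of \<open>(u; u)\<close> with \<open>j\<close> factors. The value \<open>0\<close> at negative \<open>j\<close> is the one that makes
  \<open>inv_qfac u (j - 1) = (1 - u\<^sup>j) inv_qfac u j\<close> true for every integer \<open>j\<close>; the terms of the finite
  triple product are thereby defined for all integers and no boundary cases arise.
\<close>
definition inv_qfac :: "complex \<Rightarrow> int \<Rightarrow> complex" where
  "inv_qfac u j = (if j < 0 then 0 else 1 / qfac u (nat j))"

lemma power_neq_1:
  fixes u :: complex
  assumes "norm u < 1"
  shows "u ^ Suc i \<noteq> 1"
proof
  assume "u ^ Suc i = 1"
  then have "norm u ^ Suc i = 1" by (metis norm_one norm_power)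
  moreover have "norm u ^ Suc i \<le> norm u"
    using assms power_decreasing[of 1 "Suc i" "norm u"] by simp
  ultimately show False using assms by simp
qed

lemma qfac_nonzero: "norm u < 1 \<Longrightarrow> qfac u n \<noteq> 0"
  using power_neq_1[of u] by (auto simp: qfac_def)

lemma inv_qfac_pred:
  assumes "norm u < 1" "u \<noteq> 0"
  shows "inv_qfac u (j - 1) = (1 - u powi j) * inv_qfac u j"
proof (cases "j \<le> 0")
  case True
  then show ?thesis by (cases "j = 0") (auto simp: inv_qfac_def)
next
  case False
  then obtain n where j: "j = int (Suc n)"
    by (metis not_le zero_less_imp_eq_int gr0_implies_Suc)
  have "u * u ^ n \<noteq> 1" using power_neq_1[OF assms(1), of n] by simp
  moreover have "nat (1 + int n) = Suc n" by simp
  moreover have "u powi (1 + int n) = u * u ^ n"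
    by (simp add: power_int_add assms(2))
  ultimately show ?thesis
    using qfac_nonzero[OF assms(1), of n]
    by (simp add: j inv_qfac_def qfac_def power_int_add_1' assms(2) field_simps)
qed

lemma theta_term_shift_up:
  assumes "p \<noteq> 0" "z \<noteq> 0"
  shows "theta_term p z (k + 1) = - z * p powi (2 * k) * theta_term p z k"
proof -
  have "(k + 1) * k = k * (k - 1) + 2 * k" by (simp add: algebra_simps)
  then show ?thesis
    using assms by (simp add: theta_term_def power_int_add)
qed

text \<open>
  The Gauss binomial form of the triple product. Passing from \<open>N\<close> to \<open>N + 1\<close> multiplies the product by
  \<open>(1 - z u\<^sup>N) (1 - u\<^sup>N\<^sup>+\<^sup>1 / z)\<close>, with \<open>u = p\<^sup>2\<close>; multiplying the sum by this factor mixes three neighbouring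
  terms, and the result is the sum for \<open>N + 1\<close> by a polynomial identity between the
  neighbouring \<open>q\<close>-factorials.
\<close>
lemma finite_jacobi_triple_product:
  assumes p: "p \<noteq> 0" "norm p < 1" and z: "z \<noteq> 0"
  shows "((\<lambda>k. theta_term p z k * inv_qfac (p^2) (int N + k) * inv_qfac (p^2) (int N - k))
           has_sum ((\<Prod>i<N. (1 - z * (p^2)^i) * (1 - (p^2)^Suc i / z)) / qfac (p^2) (2 * N))) UNIV"
proof (induction N)
  case 0
  have *: "inv_qfac u k * inv_qfac u (- k) = 0" if "k \<noteq> 0" for k u
    using that by (auto simp: inv_qfac_def)
  have "((\<lambda>k. theta_term p z k * inv_qfac (p^2) k * inv_qfac (p^2) (- k)) has_sum 1) {0}"
    by (rule has_sum_finiteI) (auto simp: theta_term_def inv_qfac_def qfac_def)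
  then have "((\<lambda>k. theta_term p z k * inv_qfac (p^2) k * inv_qfac (p^2) (- k)) has_sum 1) UNIV"
    by (subst has_sum_cong_neutral[where T = "{0}"]) (use * in \<open>auto simp: mult.assoc\<close>)
  then show ?case by (simp add: qfac_def)
next
  case (Suc N)
  define u where "u = p^2"
  have u: "u \<noteq> 0" "norm u < 1"
    using p by (auto simp: u_def norm_power power_less_one_iff)
  define P where "P = (\<Prod>i<N. (1 - z * u^i) * (1 - u^Suc i / z))"
  define e where "e = (\<lambda>k. theta_term p z k * inv_qfac u (int N + k) * inv_qfac u (int N - k))"
  define e' where "e' = (\<lambda>k. theta_term p z k * inv_qfac u (int (Suc N) + k) * inv_qfac u (int (Suc N) - k))"
  have e: "(e has_sum (P / qfac u (2 * N))) UNIV"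
    using Suc.IH unfolding e_def P_def u_def .
  have dn: "((\<lambda>k. e (k - 1)) has_sum (P / qfac u (2 * N))) UNIV"
    by (subst has_sum_reindex_bij_witness[where i = "\<lambda>k. k + 1" and j = "\<lambda>k. k - 1" and T = UNIV and h = e])
       (use e in auto)
  have up: "((\<lambda>k. e (k + 1)) has_sum (P / qfac u (2 * N))) UNIV"
    by (subst has_sum_reindex_bij_witness[where i = "\<lambda>k. k - 1" and j = "\<lambda>k. k + 1" and T = UNIV and h = e])
       (use e in auto)
  have nz: "1 - u ^ Suc i \<noteq> 0" for i
    using power_neq_1[OF u(2), of i] by auto
  have key: "(1 + u ^ (2*N+1)) * e k + (- z * u ^ N) * e (k - 1) + (- (u ^ Suc N) / z) * e (k + 1)
      = (1 - u ^ (2*N+1)) * (1 - u ^ (2*N+2)) * e' k" for k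
  proof -
    define a where "a = u powi (int (Suc N) + k)"
    define b where "b = u powi (int (Suc N) - k)"
    define \<alpha> where "\<alpha> = inv_qfac u (int (Suc N) + k)"
    define \<beta> where "\<beta> = inv_qfac u (int (Suc N) - k)"
    define t where "t = theta_term p z k"
    have X: "u powi k \<noteq> 0" using u by simp
    have pX: "p powi (2 * k) = u powi k"
      by (simp add: u_def power_int_mult)
    have t1: "- (u ^ Suc N) / z * theta_term p z (k + 1) = a * t"
      using theta_term_shift_up[OF p(1) z, of k] pX z u
      by (simp add: t_def a_def power_int_add)
    have "t = - z * p powi (2 * (k - 1)) * theta_term p z (k - 1)"
      using theta_term_shift_up[OF p(1) z, of "k - 1"] by (simp add: t_def)
    moreover have "p powi (2 * (k - 1)) = u powi k / u"
      using p u by (simp add: power_int_mult power_int_diff flip: u_def)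
    ultimately have t0: "(- z * u ^ N) * theta_term p z (k - 1) = b * t"
      using X z u by (simp add: field_simps b_def power_int_add power_int_diff)
    have a': "u powi (int N + k) = a / u" "u powi (int N - k) = b / u"
      using u by (simp_all add: a_def b_def power_int_add power_int_diff)
    have "int (Suc N) + k - 1 = int N + k" "int (Suc N) - k - 1 = int N - k"
      by simp_all
    then have a1: "inv_qfac u (int N + k) = (1 - a) * \<alpha>"
      and b1: "inv_qfac u (int N - k) = (1 - b) * \<beta>"
      using inv_qfac_pred[OF u(2,1), of "int (Suc N) + k"] inv_qfac_pred[OF u(2,1), of "int (Suc N) - k"]
      by (simp_all only: a_def b_def \<alpha>_def \<beta>_def)
    have "int N + k - 1 = int N + (k - 1)" "int N - k - 1 = int N - (k + 1)"
      by simp_all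
    then have a2: "inv_qfac u (int N + (k - 1)) = (1 - a / u) * ((1 - a) * \<alpha>)"
      and b2: "inv_qfac u (int N - (k + 1)) = (1 - b / u) * ((1 - b) * \<beta>)"
      using inv_qfac_pred[OF u(2,1), of "int N + k"] inv_qfac_pred[OF u(2,1), of "int N - k"]
      by (simp_all only: a1 b1 a')
    have a0: "inv_qfac u (int N + (k + 1)) = \<alpha>" and b0: "inv_qfac u (int N - (k - 1)) = \<beta>"
      by (simp_all add: \<alpha>_def \<beta>_def algebra_simps)
    have ab: "a * b = u ^ (2*N+2)"
      using u X by (simp add: a_def b_def power_int_add power_int_diff power_add mult_2)
    then have pw: "u ^ (2*N+2) = a * b" "u ^ (2*N+1) = a * b / u"
      using u by (auto simp: field_simps)
    \<comment> \<open>Up to the common factor made of t, alpha and beta this is a polynomial identity in a, b and 1/u.\<close>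
    have "(1 + u ^ (2*N+1)) * e k + (- z * u ^ N) * e (k - 1) + (- (u ^ Suc N) / z) * e (k + 1)
        = (1 + u ^ (2*N+1)) * (t * ((1 - a) * \<alpha>) * ((1 - b) * \<beta>))
          + ((- z * u ^ N) * theta_term p z (k - 1)) * ((1 - a / u) * ((1 - a) * \<alpha>)) * \<beta>
          + (- (u ^ Suc N) / z * theta_term p z (k + 1)) * \<alpha> * ((1 - b / u) * ((1 - b) * \<beta>))"
      unfolding e_def a0 b0 a1 b1 a2 b2 t_def by (simp only: mult.assoc)
    also have "\<dots> = (1 - a * b / u) * (1 - a * b) * (t * \<alpha> * \<beta>)"
      unfolding t0 t1 pw unfolding divide_inverse by algebra
    also have "\<dots> = (1 - u ^ (2*N+1)) * (1 - u ^ (2*N+2)) * e' k"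
      unfolding e'_def pw \<alpha>_def \<beta>_def t_def ..
    finally show ?thesis .
  qed
  have "((\<lambda>k. (1 + u ^ (2*N+1)) * e k + (- z * u ^ N) * e (k - 1) + (- (u ^ Suc N) / z) * e (k + 1))
      has_sum ((1 + u ^ (2*N+1)) * (P / qfac u (2*N)) + (- z * u ^ N) * (P / qfac u (2*N))
        + (- (u ^ Suc N) / z) * (P / qfac u (2*N)))) UNIV" (is "(_ has_sum ?S) _")
    by (intro has_sum_add has_sum_cmult_right e dn up)
  also have "?S = (1 - z * u ^ N) * (1 - u ^ Suc N / z) * P / qfac u (2*N)"
  proof -
    have alg: "(1 + U * V) * (R * c) + (- z * U) * (R * c) + (- V * y) * (R * c)
        = (1 - z * U) * (1 - V * y) * R * c" if "z * y = 1" for U V R c y :: complex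
      using that by algebra
    have "u ^ (2*N+1) = u ^ N * u ^ Suc N" by (simp add: power_add mult_2)
    then show ?thesis
      unfolding divide_inverse by (simp only:) (rule alg, use z in simp)
  qed
  finally have "((\<lambda>k. (1 - u ^ (2*N+1)) * (1 - u ^ (2*N+2)) * e' k)
      has_sum ((1 - z * u ^ N) * (1 - u ^ Suc N / z) * P / qfac u (2*N))) UNIV"
    unfolding key .
  moreover define c where "c = (1 - u ^ (2*N+1)) * (1 - u ^ (2*N+2))"
  ultimately have "((\<lambda>k. c * e' k) has_sum ((1 - z * u ^ N) * (1 - u ^ Suc N / z) * P / qfac u (2*N))) UNIV"
    by (simp only:)
  from has_sum_cmult_right[OF this, of "inverse c"]
  have "((\<lambda>k. inverse c * (c * e' k)) has_sum
      (inverse c * ((1 - z * u ^ N) * (1 - u ^ Suc N / z) * P / qfac u (2*N)))) UNIV" .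
  moreover have "c \<noteq> 0"
    using nz[of "2*N"] nz[of "2*N+1"] by (simp add: c_def)
  then have "inverse c * (c * e' k) = e' k" for k by simp
  moreover have "qfac u (2 * Suc N) = qfac u (2*N) * c"
    by (simp add: qfac_def c_def)
  then have "inverse c * (R / qfac u (2*N)) = R / qfac u (2 * Suc N)" for R
    by (simp add: divide_inverse)
  moreover have "(\<Prod>i<Suc N. (1 - z * u^i) * (1 - u^Suc i / z)) = (1 - z * u ^ N) * (1 - u ^ Suc N / z) * P"
    by (simp add: P_def)
  ultimately show ?case
    unfolding e'_def u_def by (simp only:)
qed

lemma qpoch_partial_tendsto:
  assumes "norm u < 1"
  shows "(\<lambda>N. \<Prod>i<N. 1 - l * u ^ i) \<longlonglongrightarrow> qpoch_inf l u"
    and "(\<And>i. l * u ^ i \<noteq> 1) \<Longrightarrow> qpoch_inf l u \<noteq> 0"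
proof -
  have "summable (\<lambda>i. norm (l * u ^ i))"
    using assms by (simp add: norm_mult norm_power summable_mult summable_geometric)
  then have "abs_convergent_prod (\<lambda>i. 1 + (- (l * u ^ i)))"
    using summable_imp_abs_convergent_prod[of "\<lambda>i. 1 - l * u ^ i"] by simp
  then have conv: "convergent_prod (\<lambda>i. 1 - l * u ^ i)"
    by (simp add: abs_convergent_prod_imp_convergent_prod)
  have "(\<lambda>N. \<Prod>i<Suc N. 1 - l * u ^ i) \<longlonglongrightarrow> qpoch_inf l u"
    using convergent_prod_LIMSEQ[OF conv] by (simp only: lessThan_Suc_atMost qpoch_inf_def)
  then show "(\<lambda>N. \<Prod>i<N. 1 - l * u ^ i) \<longlonglongrightarrow> qpoch_inf l u"
    by (rule LIMSEQ_imp_Suc)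
  show "qpoch_inf l u \<noteq> 0" if "\<And>i. l * u ^ i \<noteq> 1"
    unfolding qpoch_inf_def using that by (intro prodinf_nonzero conv) auto
qed

text \<open>
  The symmetry \<open>k \<mapsto> 1 - k\<close> fixes the quadratic weight and changes the sign. It reduces the
  negative half of the theta series to the positive half at \<open>1 / z\<close>, and it makes the series
  at \<open>z = 1\<close> cancel.
\<close>
lemma theta_term_reflect:
  assumes "z \<noteq> 0"
  shows "theta_term p z (1 - k) = - z * theta_term p (1 / z) k"
proof -
  have "(1 - k) * (1 - k - 1) = k * (k - 1)" by (simp add: algebra_simps)
  then show ?thesis
    using assms by (simp add: theta_term_def power_int_diff power_int_divide_distrib flip: power_int_minus)
       (simp add: power_int_minus power_int_minus_one_minus field_simps)
qed

lemma abs_summable_theta_term: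
  assumes p: "p \<noteq> 0" "norm p < 1" and z: "z \<noteq> 0"
  shows "(\<lambda>k. norm (theta_term p z k)) summable_on UNIV"
proof -
  have *: "summable (\<lambda>m. norm (theta_term p w (int m)))" if w: "w \<noteq> 0" for w
  proof -
    have "(\<lambda>m. norm w * (norm p ^ 2) ^ m) \<longlonglongrightarrow> norm w * 0"
      using p by (intro tendsto_mult tendsto_const LIMSEQ_power_zero) (simp add: power_less_one_iff)
    then have "eventually (\<lambda>m. norm w * (norm p ^ 2) ^ m < 1/2) sequentially"
      by (rule order_tendstoD) simp
    then obtain M where M: "\<And>m. m \<ge> M \<Longrightarrow> norm w * (norm p ^ 2) ^ m < 1/2"
      unfolding eventually_sequentially by blast
    show ?thesis
    proof (rule summable_ratio_test[of "1/2" M])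
      fix m assume "m \<ge> M"
      have "norm (theta_term p w (int (Suc m))) = norm w * (norm p ^ 2) ^ m * norm (theta_term p w (int m))"
        using theta_term_shift_up[OF p(1) w, of "int m"]
        by (simp add: norm_mult norm_power norm_power_int power_int_mult add.commute)
      also have "\<dots> \<le> 1/2 * norm (theta_term p w (int m))"
        using M[OF \<open>m \<ge> M\<close>] by (intro mult_right_mono) auto
      finally show "norm (norm (theta_term p w (int (Suc m)))) \<le> 1/2 * norm (norm (theta_term p w (int m)))"
        by simp
    qed simp
  qed
  have "theta_term p z (- 1 - int m) = - z * theta_term p (1 / z) (int (m + 2))" for m
    using theta_term_reflect[OF z, of p "int (m + 2)"] by (simp add: algebra_simps)
  moreover have "summable (\<lambda>m. norm z * norm (theta_term p (1 / z) (int (m + 2))))"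
    using summable_ignore_initial_segment[OF *[of "1 / z"], of 2] z by (intro summable_mult) auto
  ultimately have "summable (\<lambda>m. norm (theta_term p z (- 1 - int m)))"
    by (simp add: norm_mult)
  then show ?thesis
    using *[OF z] by (intro abs_summable_int_split)
qed

text \<open>
  Let \<open>N\<close> tend to infinity in the finite form. Both reciprocal \<open>q\<close>-factorials converge to
  \<open>1 / (u; u)\<close> and are bounded uniformly in \<open>N\<close> and \<open>k\<close>, so that the theta series itself serves as the
  dominating series in Tannery's theorem.
\<close>
theorem jacobi_triple_product:
  assumes p: "p \<noteq> 0" "norm p < 1" and z: "z \<noteq> 0"
  shows "(theta_term p z has_sum (qpoch_inf (p^2) (p^2) * qpoch_inf2 z (p^2 / z) (p^2))) UNIV"
proof -
  define u where "u = p^2"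
  have u: "u \<noteq> 0" "norm u < 1"
    using p by (auto simp: u_def norm_power power_less_one_iff)
  define Q where "Q = qpoch_inf u u"
  have Q: "Q \<noteq> 0"
    using qpoch_partial_tendsto(2)[OF u(2), of u] power_neq_1[OF u(2)] by (simp add: Q_def)
  have lim: "(\<lambda>n. inverse (qfac u n)) \<longlonglongrightarrow> inverse Q"
    using qpoch_partial_tendsto(1)[OF u(2), of u] Q
    by (intro tendsto_inverse) (simp_all add: qfac_def Q_def)
  have lim_shift: "(\<lambda>n. inv_qfac u (int n + k)) \<longlonglongrightarrow> inverse Q" for k
  proof -
    have "filterlim (\<lambda>n. nat (int n + k)) sequentially sequentially"
      unfolding filterlim_at_top
    proof
      fix Z
      show "eventually (\<lambda>n. Z \<le> nat (int n + k)) sequentially"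
        using eventually_ge_at_top[of "Z + nat (- k)"] by eventually_elim auto
    qed
    from filterlim_compose[OF lim this]
    have "(\<lambda>n. inverse (qfac u (nat (int n + k)))) \<longlonglongrightarrow> inverse Q" .
    moreover have "eventually (\<lambda>n. inverse (qfac u (nat (int n + k))) = inv_qfac u (int n + k)) sequentially"
      using eventually_ge_at_top[of "nat (- k)"]
      by eventually_elim (auto simp: inv_qfac_def divide_inverse)
    ultimately show ?thesis
      by (rule Lim_transform_eventually)
  qed
  obtain B where B: "\<And>n. norm (inverse (qfac u n)) \<le> B"
    using convergent_imp_Bseq[OF convergentI[OF lim]] by (auto simp: Bseq_def)
  have B0: "B \<ge> 0"
    using B[of 0] norm_ge_zero order_trans by blast
  have Bj: "norm (inv_qfac u j) \<le> B" for j
    using B[of "nat j"] B0 by (auto simp: inv_qfac_def divide_inverse)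
  define e where "e = (\<lambda>n k. theta_term p z k * inv_qfac u (int n + k) * inv_qfac u (int n - k))"
  have e_lim: "(\<lambda>n. e n k) \<longlonglongrightarrow> theta_term p z k * inverse Q * inverse Q" for k
    unfolding e_def using lim_shift[of k] lim_shift[of "- k"] by (intro tendsto_intros) auto
  have e_bound: "norm (e n k) \<le> norm (theta_term p z k) * B * B" for n k
    unfolding e_def norm_mult using B0 Bj by (intro mult_mono mult_nonneg_nonneg) auto
  define J where "J = infsum (theta_term p z) UNIV"
  have J: "(theta_term p z has_sum J) UNIV"
    using abs_summable_summable[OF abs_summable_theta_term[OF p z]] by (simp add: J_def)
  define M where "M = (\<lambda>m. (norm (theta_term p z (int m)) + norm (theta_term p z (- 1 - int m))) * B * B)"
  have "((\<lambda>k. norm (theta_term p z k)) has_sum infsum (\<lambda>k. norm (theta_term p z k)) UNIV) UNIV"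
    using abs_summable_theta_term[OF p z] by simp
  from sums_summable[OF has_sum_int_imp_sums_paired[OF this]]
  have M: "summable M"
    unfolding M_def by (intro summable_mult2)
  have "(\<lambda>n. \<Sum>m. e n (int m) + e n (- 1 - int m)) \<longlonglongrightarrow>
     (\<Sum>m. theta_term p z (int m) * inverse Q * inverse Q + theta_term p z (- 1 - int m) * inverse Q * inverse Q)"
  proof (rule tannerys_theorem[THEN conjunct2, THEN conjunct2])
    show "eventually (\<lambda>(m, n). norm (e n (int m) + e n (- 1 - int m)) \<le> M m) (at_top \<times>\<^sub>F sequentially)"
    proof (intro always_eventually allI, clarify)
      fix m n
      show "norm (e n (int m) + e n (- 1 - int m)) \<le> M m"
        using norm_triangle_ineq[of "e n (int m)" "e n (- 1 - int m)"]
          e_bound[of n "int m"] e_bound[of n "- 1 - int m"]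
        by (simp add: M_def algebra_simps)
    qed
  qed (use M in \<open>auto intro!: tendsto_intros e_lim\<close>)
  also have "(\<lambda>n. \<Sum>m. e n (int m) + e n (- 1 - int m)) =
     (\<lambda>n. ((\<Prod>i<n. 1 - z * u^i) * (\<Prod>i<n. 1 - u / z * u ^ i)) * inverse (qfac u (2 * n)))"
  proof
    fix n
    have "(e n has_sum ((\<Prod>i<n. (1 - z * u^i) * (1 - u^Suc i / z)) / qfac u (2 * n))) UNIV"
      unfolding e_def u_def by (rule finite_jacobi_triple_product[OF p z])
    from sums_unique[OF has_sum_int_imp_sums_paired[OF this]]
    show "(\<Sum>m. e n (int m) + e n (- 1 - int m)) =
       ((\<Prod>i<n. 1 - z * u^i) * (\<Prod>i<n. 1 - u / z * u ^ i)) * inverse (qfac u (2 * n))"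
      by (simp add: prod.distrib divide_inverse mult_ac)
  qed
  also have "(\<Sum>m. theta_term p z (int m) * inverse Q * inverse Q + theta_term p z (- 1 - int m) * inverse Q * inverse Q)
     = J * inverse Q * inverse Q"
    using sums_mult2[OF sums_mult2[OF has_sum_int_imp_sums_paired[OF J], of "inverse Q"], of "inverse Q"]
    by (simp add: sums_iff distrib_right)
  finally have lim1: "(\<lambda>n. ((\<Prod>i<n. 1 - z * u^i) * (\<Prod>i<n. 1 - u / z * u ^ i)) * inverse (qfac u (2 * n)))
     \<longlonglongrightarrow> J * inverse Q * inverse Q" .
  have "(\<lambda>n. inverse (qfac u (2 * n))) \<longlonglongrightarrow> inverse Q"
    by (rule filterlim_compose[OF lim]) (simp add: mult_nat_left_at_top)
  then have "(\<lambda>n. ((\<Prod>i<n. 1 - z * u^i) * (\<Prod>i<n. 1 - u / z * u ^ i)) * inverse (qfac u (2 * n)))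
     \<longlonglongrightarrow> (qpoch_inf z u * qpoch_inf (u / z) u) * inverse Q"
    by (intro tendsto_mult qpoch_partial_tendsto(1) u(2))
  from LIMSEQ_unique[OF lim1 this] have "J = Q * qpoch_inf2 z (u / z) u"
    using Q by (simp add: qpoch_inf2_def field_simps)
  then show ?thesis
    using J by (simp add: Q_def u_def)
qed

section \<open>A bilateral Lambert series as a quotient of theta functions\<close>

definition lambert_term :: "complex \<Rightarrow> complex \<Rightarrow> int \<Rightarrow> complex" where
  "lambert_term p z n = z powi n / (1 - p powi (2 * n + 1))"

text \<open>
  A lower bound for the denominators of the Lambert series that is uniform in the
  exponent, so that dividing by them preserves every bound on the terms up to a constant factor.
\<close>
lemma norm_one_minus_powi_ge:
  fixes p :: complex
  assumes p: "p \<noteq> 0" "norm p < 1" and j: "j \<noteq> 0"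
  shows "1 - norm p \<le> norm (1 - p powi j)"
proof (cases "j > 0")
  case True
  then obtain n where "j = int (Suc n)"
    by (metis zero_less_imp_eq_int gr0_implies_Suc)
  then have "norm (p powi j) \<le> norm p ^ 1"
    using p power_decreasing[of 1 "Suc n" "norm p"] by (simp only: power_int_of_nat norm_power) simp
  then show ?thesis
    using norm_triangle_ineq2[of 1 "p powi j"] by simp
next
  case False
  with j obtain n where n: "j = - int (Suc n)"
    by (metis linorder_neqE_linordered_idom neg_int_cases gr0_implies_Suc)
  define x where "x = norm p ^ Suc n"
  have x: "0 < x" "x \<le> norm p ^ 1"
    using p power_decreasing[of 1 "Suc n" "norm p"] by (simp_all add: x_def del: power_Suc)
  have "norm (p powi j) = inverse x"
    by (simp only: n power_int_minus power_int_of_nat norm_power norm_inverse x_def)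
  moreover have "1 - norm p \<le> inverse x - 1"
  proof -
    have "2 - norm p \<le> inverse (norm p)"
      using p sum_squares_ge_zero[of "1 - norm p" 0] by (simp add: field_simps power2_eq_square)
    also have "\<dots> \<le> inverse x"
      using x by (simp add: le_imp_inverse_le)
    finally show ?thesis by simp
  qed
  ultimately show ?thesis
    using norm_triangle_ineq2[of "p powi j" 1] by (simp add: norm_minus_commute)
qed

lemma one_minus_powi_nonzero:
  fixes p :: complex
  assumes "p \<noteq> 0" "norm p < 1" "j \<noteq> 0"
  shows "p powi j \<noteq> 1"
  using norm_one_minus_powi_ge[OF assms] assms by auto

lemma norm_divide_one_minus_powi_le:
  fixes p :: complex
  assumes "p \<noteq> 0" "norm p < 1" "j \<noteq> 0"
  shows "norm (x / (1 - p powi j)) \<le> norm x / (1 - norm p)"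
  using norm_one_minus_powi_ge[OF assms] assms unfolding norm_divide
  by (intro divide_left_mono mult_pos_pos) auto

lemma lambert_term_nat: "lambert_term p z (int m) = z ^ m / (1 - p ^ (2 * m + 1))"
proof -
  have "2 * int m + 1 = int (2 * m + 1)" by simp
  then show ?thesis unfolding lambert_term_def by (simp only: power_int_of_nat)
qed

lemma lambert_term_neg:
  assumes "p \<noteq> 0" "norm p < 1" "z \<noteq> 0"
  shows "lambert_term p z (- 1 - int m) = - (p / z) * (p^2 / z) ^ m / (1 - p ^ (2 * m + 1))"
proof -
  have e: "2 * (- 1 - int m) + 1 = - int (2 * m + 1)" "- 1 - int m = - int (Suc m)" by simp_all
  define y where "y = p ^ (2 * m + 1)"
  have "y \<noteq> 1" "y \<noteq> 0"
    using power_neq_1[OF assms(2), of "2 * m"] assms(1) by (simp_all add: y_def)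
  moreover have "- (p / z) * (p^2 / z) ^ m = - (y / z ^ Suc m)"
    by (simp add: y_def power_divide power_mult)
  ultimately show ?thesis
    using assms(3) unfolding lambert_term_def e(1) unfolding e(2) power_int_minus power_int_of_nat y_def[symmetric]
    by (simp add: field_simps)
qed

text \<open>
  For \<open>n \<ge> 0\<close> the terms behave like \<open>z\<^sup>n\<close>, and for \<open>n = -1 - m\<close> like \<open>(p\<^sup>2 / z)\<^sup>m\<close>; this is where the
  annulus comes from.
\<close>
lemma abs_summable_lambert_term:
  assumes p: "p \<noteq> 0" "norm p < 1" and z: "norm p ^ 2 < norm z" "norm z < 1"
  shows "(\<lambda>n. norm (lambert_term p z n)) summable_on UNIV"
proof (rule abs_summable_int_split)
  have z0: "z \<noteq> 0" using z by auto
  have le: "norm (x / (1 - p ^ (2 * m + 1))) \<le> norm x / (1 - norm p)" for m x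
    using norm_divide_one_minus_powi_le[OF p, of "int (2 * m + 1)"] unfolding power_int_of_nat by simp
  show "summable (\<lambda>m. norm (lambert_term p z (int m)))"
  proof (rule summable_comparison_test')
    show "summable (\<lambda>m. norm z ^ m / (1 - norm p))"
      using z by (intro summable_divide summable_geometric) auto
    show "norm (norm (lambert_term p z (int m))) \<le> norm z ^ m / (1 - norm p)" for m
      using le[of "z ^ m" m] by (simp add: lambert_term_nat norm_power)
  qed
  show "summable (\<lambda>m. norm (lambert_term p z (- 1 - int m)))"
  proof (rule summable_comparison_test')
    show "summable (\<lambda>m. norm (p / z) * norm (p\<^sup>2 / z) ^ m / (1 - norm p))"
      using z z0 by (intro summable_divide summable_mult summable_geometric)
        (auto simp: norm_divide norm_power)
    show "norm (norm (lambert_term p z (- 1 - int m))) \<le> norm (p / z) * norm (p\<^sup>2 / z) ^ m / (1 - norm p)" for m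
      unfolding lambert_term_neg[OF p z0] real_norm_def abs_norm_cancel
      using le[of "- (p / z) * (p^2 / z) ^ m" m] unfolding norm_mult norm_minus_cancel norm_power .
  qed
qed

lemma has_sum_times_abs_summable:
  fixes f g :: "int \<Rightarrow> complex"
  assumes "(\<lambda>n. norm (f n)) summable_on UNIV" "(\<lambda>n. norm (g n)) summable_on UNIV"
    and f: "(f has_sum A) UNIV" and g: "(g has_sum B) UNIV"
  shows "((\<lambda>(n, k). f n * g k) has_sum (A * B)) (UNIV \<times> UNIV)"
proof (rule has_sum_SigmaI)
  show "((\<lambda>k. case (n, k) of (n, k) \<Rightarrow> f n * g k) has_sum (f n * B)) UNIV" for n
    using g by (simp add: has_sum_cmult_right)
  show "((\<lambda>n. f n * B) has_sum A * B) UNIV"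
    using f by (rule has_sum_cmult_left)
  have "(\<lambda>x. norm ((\<lambda>(n, k). f n * g k) x)) summable_on UNIV \<times> UNIV"
  proof (rule summable_on_SigmaI)
    show "((\<lambda>k. norm (case (n, k) of (n, k) \<Rightarrow> f n * g k)) has_sum (norm (f n) * infsum (\<lambda>k. norm (g k)) UNIV)) UNIV" for n
      using assms(2) by (simp add: norm_mult has_sum_cmult_right)
    show "(\<lambda>n. norm (f n) * infsum (\<lambda>k. norm (g k)) UNIV) summable_on UNIV"
      using assms(1) by (intro summable_on_cmult_left)
  qed auto
  then show "(\<lambda>(n, k). f n * g k) summable_on UNIV \<times> UNIV"
    by (rule abs_summable_summable)
qed

text \<open>
  The coefficient of \<open>z\<^sup>N\<close> in the product of the Lambert series and the theta series. The one for
  \<open>N = 0\<close> is the constant \<open>T(p)\<close> of the introduction.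
\<close>
definition lambert_theta_coeff :: "complex \<Rightarrow> int \<Rightarrow> complex" where
  "lambert_theta_coeff p N = (\<Sum>\<^sub>\<infinity>k. theta_term p 1 k / (1 - p powi (2 * (N - k) + 1)))"

lemma has_sum_lambert_theta_coeff:
  assumes p: "p \<noteq> 0" "norm p < 1"
  shows "((\<lambda>k. theta_term p 1 k / (1 - p powi (2 * (N - k) + 1))) has_sum lambert_theta_coeff p N) UNIV"
proof -
  have "(\<lambda>k. norm (theta_term p 1 k / (1 - p powi (2 * (N - k) + 1)))) summable_on UNIV"
  proof (rule Infinite_Sum.abs_summable_on_comparison_test')
    show "(\<lambda>k. norm (theta_term p 1 k) * inverse (1 - norm p)) summable_on UNIV"
      using abs_summable_theta_term[OF p, of 1] by (intro summable_on_cmult_left) auto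
    show "norm (theta_term p 1 k / (1 - p powi (2 * (N - k) + 1))) \<le> norm (theta_term p 1 k) * inverse (1 - norm p)" for k
    proof -
      have "2 * (N - k) + 1 \<noteq> 0" by presburger
      from norm_divide_one_minus_powi_le[OF p this, of "theta_term p 1 k"] show ?thesis
        by (simp only: divide_inverse)
    qed
  qed
  from abs_summable_summable[OF this] show ?thesis
    by (simp add: lambert_theta_coeff_def)
qed

lemma has_sum_theta_term_1:
  assumes p: "p \<noteq> 0" "norm p < 1"
  shows "(theta_term p 1 has_sum 0) UNIV"
proof -
  obtain S where S: "(theta_term p 1 has_sum S) UNIV"
    using abs_summable_summable[OF abs_summable_theta_term[OF p, of 1]] summable_on_def by auto
  then have "((\<lambda>k. theta_term p 1 (1 - k)) has_sum S) UNIV"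
    by (subst has_sum_reindex_bij_witness[where i = "\<lambda>k. 1 - k" and j = "\<lambda>k. 1 - k" and T = UNIV
          and h = "theta_term p 1" and s' = S]) auto
  then have "((\<lambda>k. - theta_term p 1 k) has_sum S) UNIV"
    by (simp add: theta_term_reflect)
  then have "S = - S"
    using has_sum_unique[OF _ has_sum_uminusI[OF S]] by blast
  then show ?thesis using S by simp
qed

text \<open>
  Shifting the summation index in the sum for \<open>N + 1\<close> aligns its denominators with those of the
  sum for \<open>N\<close>. In the stated combination the denominators then cancel, and what remains is the
  theta series at \<open>z = 1\<close>, which is zero.
\<close>
lemma lambert_theta_coeff_step:
  assumes p: "p \<noteq> 0" "norm p < 1"
  shows "lambert_theta_coeff p (N + 1) = - (p powi (2 * N + 1)) * lambert_theta_coeff p N"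
proof -
  have A: "((\<lambda>k. theta_term p 1 (k + 1) / (1 - p powi (2 * (N - k) + 1))) has_sum lambert_theta_coeff p (N + 1)) UNIV"
    by (subst has_sum_reindex_bij_witness[where i = "\<lambda>k. k - 1" and j = "\<lambda>k. k + 1" and T = UNIV
          and h = "\<lambda>k. theta_term p 1 k / (1 - p powi (2 * (N + 1 - k) + 1))" and s' = "lambert_theta_coeff p (N + 1)"])
       (use has_sum_lambert_theta_coeff[OF p, of "N + 1"] in auto)
  have "((\<lambda>k. theta_term p 1 (k + 1)) has_sum 0) UNIV"
    by (subst has_sum_reindex_bij_witness[where i = "\<lambda>k. k - 1" and j = "\<lambda>k. k + 1" and T = UNIV
          and h = "theta_term p 1" and s' = 0])
       (use has_sum_theta_term_1[OF p] in auto)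
  moreover have "theta_term p 1 (k + 1) / (1 - p powi (2 * (N - k) + 1)) +
      p powi (2 * N + 1) * (theta_term p 1 k / (1 - p powi (2 * (N - k) + 1))) = theta_term p 1 (k + 1)" for k
  proof -
    define D where "D = 1 - p powi (2 * (N - k) + 1)"
    have "2 * (N - k) + 1 \<noteq> 0" by presburger
    then have "D \<noteq> 0" using one_minus_powi_nonzero[OF p] by (auto simp: D_def)
    have "p powi (2 * k + (2 * (N - k) + 1)) = p powi (2 * k) * p powi (2 * (N - k) + 1)"
      using p by (intro power_int_add) simp
    then have "p powi (2 * N + 1) = p powi (2 * k) * (1 - D)"
      by (simp add: D_def)
    then have "theta_term p 1 (k + 1) + p powi (2 * N + 1) * theta_term p 1 k = theta_term p 1 (k + 1) * D"
      using theta_term_shift_up[OF p(1), of 1 k] by algebra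
    then show ?thesis
      using \<open>D \<noteq> 0\<close> unfolding D_def[symmetric]
      by (metis add_divide_distrib nonzero_mult_div_cancel_right times_divide_eq_right)
  qed
  ultimately have "((\<lambda>k. theta_term p 1 (k + 1) / (1 - p powi (2 * (N - k) + 1)) +
      p powi (2 * N + 1) * (theta_term p 1 k / (1 - p powi (2 * (N - k) + 1)))) has_sum 0) UNIV"
    by simp
  moreover have "((\<lambda>k. theta_term p 1 (k + 1) / (1 - p powi (2 * (N - k) + 1)) +
      p powi (2 * N + 1) * (theta_term p 1 k / (1 - p powi (2 * (N - k) + 1)))) has_sum
      (lambert_theta_coeff p (N + 1) + p powi (2 * N + 1) * lambert_theta_coeff p N)) UNIV"
    by (intro has_sum_add A has_sum_cmult_right has_sum_lambert_theta_coeff p)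
  ultimately have "lambert_theta_coeff p (N + 1) + p powi (2 * N + 1) * lambert_theta_coeff p N = 0"
    using has_sum_unique by blast
  then show ?thesis by (simp add: add_eq_0_iff)
qed

lemma lambert_theta_coeff_eq:
  assumes p: "p \<noteq> 0" "norm p < 1"
  shows "lambert_theta_coeff p N = theta_term p p N * lambert_theta_coeff p 0"
proof (induction N rule: int_induct[of _ 0])
  case base
  then show ?case by (simp add: theta_term_def)
next
  case (step1 N)
  have "theta_term p p (N + 1) = - (p powi (2 * N + 1)) * theta_term p p N"
    using theta_term_shift_up[OF p(1) p(1), of N] p by (simp add: power_int_add)
  then show ?case using lambert_theta_coeff_step[OF p, of N] step1 by simp
next
  case (step2 N)
  have "p powi (2 * (N - 1) + 1) \<noteq> 0" using p by simp
  moreover have "p powi (2 * (N - 1) + 1) = p * p powi (2 * (N - 1))"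
    using p by (subst power_int_add) auto
  then have "theta_term p p N = - (p powi (2 * (N - 1) + 1)) * theta_term p p (N - 1)"
    using theta_term_shift_up[OF p(1) p(1), of "N - 1"] by simp
  ultimately show ?case using lambert_theta_coeff_step[OF p, of "N - 1"] step2 by simp
qed

text \<open>
  The case \<open>a = p\<close> with base \<open>p\<^sup>2\<close> of the bilateral sum of \<open>z\<^sup>n / (1 - a q\<^sup>n)\<close> which follows from
  Ramanujan's \<open>1\<psi>1\<close> summation. Its proof multiplies by the theta series: by the recursion for the coefficients,
  the product of Lambert and theta series at \<open>z\<close> is a constant times the theta series at
  \<open>p z\<close>, and the triple product turns both theta series into products with the same constant
  factor. The constant is independent of \<open>z\<close>.
\<close>
theorem lambert_series_eq_theta_quotient:
  assumes p: "p \<noteq> 0" "norm p < 1" and z: "norm p ^ 2 < norm z" "norm z < 1"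
  shows "(lambert_term p z has_sum
           (lambert_theta_coeff p 0 * (qpoch_inf2 (p / z) (p * z) (p^2) / qpoch_inf2 z (p^2 / z) (p^2)))) UNIV"
proof -
  have z0: "z \<noteq> 0" using z by auto
  have u: "norm (p^2) < 1" using p by (simp add: norm_power power_less_one_iff)
  define Q where "Q = qpoch_inf (p^2) (p^2)"
  have Q: "Q \<noteq> 0"
    using qpoch_partial_tendsto(2)[OF u, of "p^2"] power_neq_1[OF u] by (simp add: Q_def)
  obtain F where F: "(lambert_term p z has_sum F) UNIV"
    using abs_summable_summable[OF abs_summable_lambert_term[OF p z]] summable_on_def by auto
  define \<theta> where "\<theta> = qpoch_inf2 z (p^2 / z) (p^2)"
  have J: "(theta_term p z has_sum (Q * \<theta>)) UNIV"
    using jacobi_triple_product[OF p z0] by (simp add: Q_def \<theta>_def)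
  have "((\<lambda>(n, k). lambert_term p z n * theta_term p z k) has_sum (F * (Q * \<theta>))) (UNIV \<times> UNIV)"
    by (intro has_sum_times_abs_summable F J abs_summable_lambert_term abs_summable_theta_term p z z0)
  \<comment> \<open>Substituting N = n + k collects the terms of the double series by powers of z.\<close>
  then have double: "((\<lambda>(N, k). lambert_term p z (N - k) * theta_term p z k) has_sum (F * (Q * \<theta>))) (UNIV \<times> UNIV)"
    by (subst has_sum_reindex_bij_witness[where i = "\<lambda>(n, k). (n + k, k)" and j = "\<lambda>(N, k). (N - k, k)"
          and T = "UNIV \<times> UNIV" and h = "\<lambda>(n, k). lambert_term p z n * theta_term p z k" and s' = "F * (Q * \<theta>)"])
       auto
  have term_eq: "lambert_term p z (N - k) * theta_term p z k
      = z powi N * (theta_term p 1 k / (1 - p powi (2 * (N - k) + 1)))" for N k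
    using z0 by (simp add: lambert_term_def theta_term_def power_int_diff)
  have inner: "((\<lambda>k. lambert_term p z (N - k) * theta_term p z k) has_sum (lambert_theta_coeff p 0 * theta_term p (p * z) N)) UNIV" for N
  proof -
    have "z powi N * lambert_theta_coeff p N = lambert_theta_coeff p 0 * theta_term p (p * z) N"
      unfolding lambert_theta_coeff_eq[OF p, of N] by (simp add: theta_term_def power_int_mult_distrib)
    then show ?thesis
      using has_sum_cmult_right[OF has_sum_lambert_theta_coeff[OF p, of N], of "z powi N"]
      unfolding term_eq by simp
  qed
  have "((\<lambda>N. lambert_theta_coeff p 0 * theta_term p (p * z) N) has_sum (F * (Q * \<theta>))) UNIV"
    by (rule has_sum_SigmaD[OF double]) (use inner in simp)
  moreover have "((\<lambda>N. lambert_theta_coeff p 0 * theta_term p (p * z) N) has_sum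
      (lambert_theta_coeff p 0 * (Q * qpoch_inf2 (p * z) (p^2 / (p * z)) (p^2)))) UNIV"
    using jacobi_triple_product[OF p, of "p * z"] p z0 unfolding Q_def by (intro has_sum_cmult_right) auto
  ultimately have "F * (Q * \<theta>) = lambert_theta_coeff p 0 * (Q * qpoch_inf2 (p * z) (p^2 / (p * z)) (p^2))"
    by (rule has_sum_unique)
  moreover have "p^2 / (p * z) = p / z" using p by (simp add: power2_eq_square)
  ultimately have "F * \<theta> = lambert_theta_coeff p 0 * qpoch_inf2 (p / z) (p * z) (p^2)"
    using Q by (simp add: qpoch_inf2_def mult_ac)
  moreover have "\<theta> \<noteq> 0"
  proof -
    have ne: "l * (p^2) ^ i \<noteq> 1" if "norm l < 1" for l i
    proof
      assume "l * (p^2) ^ i = 1"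
      then have "norm l * norm ((p^2) ^ i) = 1" by (metis norm_mult norm_one)
      moreover have "norm ((p^2) ^ i) \<le> 1" 
        using p by (simp add: norm_power power_le_one flip: power_mult)
      then have "norm l * norm ((p^2) ^ i) \<le> norm l * 1" by (intro mult_left_mono) auto
      ultimately show False using that by simp
    qed
    have "norm (p^2 / z) < 1" using z z0 by (simp add: norm_divide norm_power)
    then show ?thesis
      using qpoch_partial_tendsto(2)[OF u ne] z by (simp add: \<theta>_def qpoch_inf2_def)
  qed
  ultimately have "F = lambert_theta_coeff p 0 * (qpoch_inf2 (p / z) (p * z) (p^2) / \<theta>)"
    by (simp add: field_simps)
  then show ?thesis using F by (simp add: \<theta>_def)
qed

section \<open>Vanishing of the Lambert series along an arithmetic progression\<close>

lemma has_sum_geometric: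
  fixes x :: complex
  assumes "norm x < 1"
  shows "((\<lambda>k. x ^ k) has_sum (1 / (1 - x))) UNIV"
  using assms by (intro norm_summable_imp_has_sum geometric_sums) (simp_all add: norm_power summable_geometric)

text \<open>
  Expanding the denominator geometrically gives the sum of \<open>z\<^sup>m w\<^sup>k (z w)\<^sup>m\<^sup>k\<close> over all \<open>m, k \<ge> 0\<close>, which is
  unchanged when \<open>z\<close> and \<open>w\<close> are interchanged together with \<open>m\<close> and \<open>k\<close>.
\<close>
lemma lambert_series_symmetry:
  fixes z w :: complex
  assumes zw: "norm z < 1" "norm w < 1"
  shows "\<exists>S. ((\<lambda>m. z ^ m / (1 - w * (z * w) ^ m)) has_sum S) UNIV \<and>
             ((\<lambda>m. w ^ m / (1 - z * (z * w) ^ m)) has_sum S) UNIV"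
proof -
  define G where "G = (\<lambda>(m, k). z ^ m * w ^ k * (z * w) ^ (m * k))"
  have zw1: "norm (z * w) ^ n \<le> 1" for n
    using zw by (intro power_le_one) (auto simp: norm_mult mult_le_one)
  have row: "((\<lambda>k. z' ^ m * w' ^ k * (z' * w') ^ (m * k)) has_sum (z' ^ m / (1 - w' * (z' * w') ^ m))) UNIV"
    if "norm z' < 1" "norm w' < 1" for z' w' :: complex and m
  proof -
    have "norm (z' * w') ^ m \<le> 1"
      using that by (intro power_le_one) (auto simp: norm_mult mult_le_one)
    then have "norm w' * norm (z' * w') ^ m \<le> norm w' * 1"
      by (intro mult_left_mono) auto
    then have "norm (w' * (z' * w') ^ m) < 1"
      using that unfolding norm_mult norm_power by linarith
    from has_sum_cmult_right[OF has_sum_geometric[OF this], of "z' ^ m"] show ?thesis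
      by (simp only: power_mult_distrib[of w' "(z' * w') ^ m"] power_mult mult.assoc times_divide_eq_right mult_1_right)
  qed
  have "(\<lambda>x. norm (G x)) summable_on UNIV \<times> UNIV"
  proof (rule Infinite_Sum.abs_summable_on_comparison_test')
    show "(\<lambda>(m, k). norm z ^ m * norm w ^ k) summable_on UNIV \<times> UNIV"
    proof (rule summable_on_SigmaI)
      have g: "((\<lambda>k. x ^ k) has_sum (1 / (1 - x))) UNIV" if "0 \<le> x" "x < 1" for x :: real
        using that by (intro norm_summable_imp_has_sum geometric_sums) (simp_all add: summable_geometric)
      show "((\<lambda>k. case (m, k) of (m, k) \<Rightarrow> norm z ^ m * norm w ^ k) has_sum (norm z ^ m * (1 / (1 - norm w)))) UNIV" for m
        unfolding prod.case using zw by (intro has_sum_cmult_right g) auto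
      show "(\<lambda>m. norm z ^ m * (1 / (1 - norm w))) summable_on UNIV"
        using g[of "norm z"] zw by (intro summable_on_cmult_left) (auto simp: summable_on_def)
    qed auto
    show "norm (G x) \<le> (case x of (m, k) \<Rightarrow> norm z ^ m * norm w ^ k)" for x
      using mult_left_mono[OF zw1[of "fst x * snd x"], of "norm z ^ fst x * norm w ^ snd x"]
      by (simp add: G_def case_prod_unfold norm_mult norm_power)
  qed
  then obtain S where S: "(G has_sum S) (UNIV \<times> UNIV)"
    using abs_summable_summable summable_on_def by blast
  have "((\<lambda>m. z ^ m / (1 - w * (z * w) ^ m)) has_sum S) UNIV"
    by (rule has_sum_SigmaD[OF S]) (use row[OF zw] in \<open>simp add: G_def\<close>)
  moreover have "((\<lambda>k. w ^ k / (1 - z * (z * w) ^ k)) has_sum S) UNIV"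
  proof (rule has_sum_SigmaD)
    show "((\<lambda>(k, m). G (m, k)) has_sum S) (UNIV \<times> UNIV)"
      using S by (subst (asm) has_sum_swap) simp
    show "((\<lambda>m. case (k, m) of (k, m) \<Rightarrow> G (m, k)) has_sum (w ^ k / (1 - z * (z * w) ^ k))) UNIV" for k
      using row[OF zw(2,1), of k] by (simp add: G_def mult_ac)
  qed
  ultimately show ?thesis by blast
qed

text \<open>
  The terms with negative index are those of the series with \<open>z\<close> and \<open>w\<close> interchanged, with the
  opposite sign. In terms of theta functions, the sum is proportional to the theta function with base \<open>z w\<close>
  evaluated at its zero \<open>z w\<close>.
\<close>
lemma bilateral_lambert_series_zero:
  fixes z w :: complex
  assumes nz: "z \<noteq> 0" "w \<noteq> 0" and zw: "norm z < 1" "norm w < 1"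
  shows "((\<lambda>m. z powi m / (1 - w * (z * w) powi m)) has_sum 0) UNIV"
proof -
  obtain S where S: "((\<lambda>m. z ^ m / (1 - w * (z * w) ^ m)) has_sum S) UNIV"
      "((\<lambda>m. w ^ m / (1 - z * (z * w) ^ m)) has_sum S) UNIV"
    using lambert_series_symmetry[OF zw] by blast
  have neg: "z powi (- 1 - int m) / (1 - w * (z * w) powi (- 1 - int m)) = - (w ^ m / (1 - z * (z * w) ^ m))" for m
  proof -
    define y where "y = z * (z * w) ^ m"
    have "norm y \<le> norm z * 1"
      unfolding y_def norm_mult norm_power using zw by (intro mult_left_mono power_le_one) (auto simp: mult_le_one)
    then have y: "y \<noteq> 0" "y \<noteq> 1" using nz zw by (auto simp: y_def)
    have e: "- 1 - int m = - int (Suc m)" by simp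
    have "w * (z * w) powi (- 1 - int m) = inverse y"
      unfolding e power_int_minus power_int_of_nat using nz by (simp add: y_def field_simps)
    moreover have "z powi (- 1 - int m) = w ^ m / y"
      unfolding e power_int_minus power_int_of_nat using nz by (simp add: y_def field_simps)
    ultimately have "z powi (- 1 - int m) / (1 - w * (z * w) powi (- 1 - int m)) = (w ^ m / y) / (1 - inverse y)"
      by simp
    also have "\<dots> = - (w ^ m / (1 - y))"
      using y by (simp add: field_simps)
    finally show ?thesis by (simp add: y_def)
  qed
  have "((\<lambda>m. z powi m / (1 - w * (z * w) powi m)) has_sum (S + (- S))) UNIV"
    by (rule has_sum_int_split) (use S has_sum_uminusI[OF S(2)] in \<open>simp_all add: neg\<close>)
  then show ?thesis by simp
qed

text \<open>
  Along \<open>n = M m + n0\<close>, the summand is a constant times the summand of the preceding lemma with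
  \<open>z = p\<^sup>b\<close> and \<open>w = p\<close> to the power \<open>2 n0 + 1\<close>, where \<open>p = q\<^sup>M\<close>. The condition linking \<open>b\<close>, \<open>n0\<close> and \<open>M\<close> says that
  \<open>z w\<close> is exactly the ratio \<open>p\<close> to the power \<open>2 M\<close> of consecutive powers in the denominators.
\<close>
lemma lambert_term_progression_has_sum_0:
  assumes q: "q \<noteq> 0" "norm q < 1" and M: "b + 2 * n0 + 1 = 2 * M" and b: "0 < b"
  shows "(lambert_term (q ^ M) (q ^ b) has_sum 0) {n. [n = int n0] (mod int M)}"
proof -
  define p where "p = q ^ M"
  have M0: "M > 0" using M by auto
  have p: "p \<noteq> 0" "norm p < 1"
    using q M0 by (auto simp: p_def norm_power power_less_one_iff)
  have eq: "lambert_term p (q ^ b) (int M * m + int n0) =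
      q ^ (b * n0) * ((p ^ b) powi m / (1 - p ^ (2 * n0 + 1) * (p ^ b * p ^ (2 * n0 + 1)) powi m))" for m
  proof -
    have "(q ^ b) powi (int M * m + int n0) = q ^ (b * n0) * (p ^ b) powi m"
    proof -
      have "(q ^ b) ^ M = p ^ b" by (simp add: p_def mult.commute flip: power_mult)
      moreover have "q ^ b \<noteq> 0" using q by simp
      moreover have "(q ^ b) powi (int M * m) = ((q ^ b) ^ M) powi m"
        by (simp only: power_int_mult power_int_of_nat)
      ultimately show ?thesis
        by (simp add: power_int_add power_mult mult.commute)
    qed
    moreover have "p ^ b * p ^ (2 * n0 + 1) = p ^ (2 * M)"
      by (simp only: M[symmetric] power_add mult.assoc)
    moreover have "p powi (2 * (int M * m + int n0) + 1) = p ^ (2 * n0 + 1) * (p ^ (2 * M)) powi m"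
    proof -
      have "2 * (int M * m + int n0) + 1 = int (2 * n0 + 1) + int (2 * M) * m" by (simp add: algebra_simps)
      moreover have "p powi (int (2 * n0 + 1) + int (2 * M) * m) = p powi int (2 * n0 + 1) * p powi (int (2 * M) * m)"
        using p by (intro power_int_add) simp
      ultimately show ?thesis by (simp only: power_int_mult power_int_of_nat)
    qed
    ultimately show ?thesis by (simp add: lambert_term_def)
  qed
  have "((\<lambda>m. lambert_term p (q ^ b) (int M * m + int n0)) has_sum (q ^ (b * n0) * 0)) UNIV"
    unfolding eq
  proof (intro has_sum_cmult_right bilateral_lambert_series_zero)
    show "norm (p ^ b) < 1" "norm (p ^ (2 * n0 + 1)) < 1"
      unfolding norm_power using p b by (subst power_less_one_iff; simp)+
  qed (use p in auto)
  then have "(lambert_term p (q ^ b) has_sum (q ^ (b * n0) * 0)) {n. [n = int n0] (mod int M)}"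
    by (subst has_sum_reindex_bij_witness[where i = "\<lambda>m. int M * m + int n0" and j = "\<lambda>n. (n - int n0) div int M" and T = UNIV
          and h = "\<lambda>m. lambert_term p (q ^ b) (int M * m + int n0)" and s' = "q ^ (b * n0) * 0"])
       (use M0 in \<open>auto simp: cong_iff_dvd_diff\<close>)
  then show ?thesis by (simp add: p_def)
qed

text \<open>
  If the constant were zero, the Lambert series would vanish throughout its annulus. But at
  \<open>z = sqrt x\<close> all the terms become positive after pairing \<open>m\<close> with \<open>-1 - m\<close>.
\<close>
lemma lambert_theta_coeff_nonzero:
  fixes x :: real
  assumes x: "0 < x" "x < 1"
  shows "lambert_theta_coeff (of_real x) 0 \<noteq> 0"
proof
  assume zero: "lambert_theta_coeff (of_real x) 0 = 0"
  define z where "z = sqrt x"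
  have z: "x < z" "z < 1" "x = z * z" "0 < z"
    using x real_less_rsqrt[of x x] by (auto simp: z_def power2_eq_square)
  define g where "g = (\<lambda>m. (z ^ m - x / z * (x^2 / z) ^ m) / (1 - x ^ (2 * m + 1)))"
  have pos: "g m > 0" for m
  proof -
    have "x^2 / z \<le> z" using z x by (simp add: field_simps power2_eq_square mult_le_one)
    then have "(x^2 / z) ^ m \<le> z ^ m" using z x by (intro power_mono) auto
    moreover have "x / z < 1" using z by simp
    ultimately have "x / z * (x^2 / z) ^ m < 1 * z ^ m"
      using z x by (intro mult_less_le_imp_less) auto
    moreover have "x ^ (2 * m + 1) < 1"
      using x power_less_one_iff[of x "2 * m + 1"] by simp
    ultimately show ?thesis by (simp add: g_def)
  qed
  have xc: "complex_of_real x \<noteq> 0" "norm (complex_of_real x) < 1" using x by auto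
  have zc: "complex_of_real z \<noteq> 0" using z by auto
  have "x^2 < z" using x z(1) power_decreasing[of 1 2 x] by simp
  then have "norm (complex_of_real x) ^ 2 < norm (complex_of_real z)" "norm (complex_of_real z) < 1"
    using z(2,4) by (simp_all only: norm_of_real power2_abs abs_of_pos)
  from lambert_series_eq_theta_quotient[OF xc this] zero
  have "(lambert_term (of_real x) (of_real z) has_sum 0) UNIV" by simp
  from has_sum_int_imp_sums_paired[OF this]
  have "(\<lambda>m. complex_of_real (g m)) sums of_real 0"
    unfolding lambert_term_nat lambert_term_neg[OF xc zc] by (simp add: g_def diff_divide_distrib)
  then have "g sums 0"
    by (simp only: sums_of_real_iff)
  then show False
    using suminf_pos[of g] pos by (auto simp: sums_iff)
qed

section \<open>Extraction of coefficients\<close>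

lemma sum_root_of_unity_powers:
  fixes j :: int
  assumes "M > 0"
  shows "(\<Sum>k<M. cis (2 * pi / real M) powi (int k * j)) = (if int M dvd j then of_nat M else 0)"
proof -
  define x where "x = cis (2 * pi / real M) powi j"
  have eq: "cis (2 * pi / real M) powi (int k * j) = x ^ k" for k
    by (simp add: x_def mult.commute power_int_mult)
  have one: "cis (2 * pi / real M) ^ M = 1"
    using assms by (simp add: Complex.DeMoivre)
  show ?thesis
  proof (cases "int M dvd j")
    case True
    then obtain l where "j = int M * l" by blast
    then have "x = 1" using one by (simp add: x_def power_int_mult)
    then show ?thesis using True by (simp add: eq)
  next
    case False
    have "x \<noteq> 1"
    proof
      assume "x = 1"
      then have "cis (of_int j * (2 * pi / real M)) = 1" by (simp add: x_def cis_power_int)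
      then have "cos (of_int j * (2 * pi / real M)) = 1" by (simp add: complex_eq_iff)
      then obtain n :: int where "of_int j * (2 * pi / real M) = of_int n * 2 * pi"
        using cos_one_2pi_int by auto
      then have "real_of_int j = real_of_int (int M * n)" using assms by (simp add: field_simps)
      then have "j = int M * n" by (simp only: of_int_eq_iff)
      with False show False by simp
    qed
    moreover have "x ^ M = cis (2 * pi / real M) powi (int M * j)"
      by (simp only: x_def power_int_power' mult.commute)
    then have "x ^ M = 1"
      using one by (simp add: power_int_mult)
    ultimately show ?thesis using False by (simp add: eq geometric_sum)
  qed
qed

text \<open>
  Zeros of a nonzero power series are isolated. The factor \<open>q\<close> in the proof makes the
  series vanish at its centre, as \<open>powser_0_nonzero\<close> requires.
\<close>
lemma powser_zero_on_unit_interval: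
  fixes g :: "nat \<Rightarrow> complex"
  assumes sums: "\<And>q. norm q < 1 \<Longrightarrow> (\<lambda>n. g n * q ^ n) sums f q"
      and zero: "\<And>x. 0 < x \<Longrightarrow> x < 1 \<Longrightarrow> f (of_real x) = 0"
  shows "g n = 0"
proof (rule ccontr)
  assume n: "g n \<noteq> 0"
  define h where "h = (\<lambda>m. if m = 0 then 0 else g (m - 1))"
  have h: "(\<lambda>m. h m * (q - 0) ^ m) sums (q * f q)" if "norm (q - 0) < 1" for q
  proof -
    have "(\<lambda>m. h (Suc m) * (q - 0) ^ Suc m) sums (q * f q)"
      using sums_mult[OF sums, of q q] that by (simp add: h_def mult_ac)
    then show ?thesis
      by (subst (asm) sums_Suc_iff) (simp add: h_def)
  qed
  show False
  proof (rule powser_0_nonzero[where r = 1 and \<xi> = 0 and a = h and f = "\<lambda>q. q * f q" and m = "Suc n"])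
    fix s :: real
    assume s: "0 < s" "\<And>z. z \<in> cball 0 s - {0} \<Longrightarrow> z * f z \<noteq> 0"
    define x where "x = min s (1/2)"
    have "0 < x" "x < 1" "x \<le> s" using s(1) by (auto simp: x_def)
    then show False using s(2)[of "of_real x"] zero[of x] by auto
  next
    show "h (Suc n) \<noteq> 0" using n by (simp add: h_def)
  qed (simp_all only: zero_less_one zero_less_Suc mult_zero_left h)
qed

text \<open>
  A root of unity filter applied to the quotient at \<open>\<omega>\<^sup>k q\<close>, \<open>k < M\<close>, isolates the coefficients with index
  \<open>n \<equiv> r\<close> modulo \<open>M\<close>. On the side of the Lambert series, \<open>p = q\<^sup>M\<close> does not change under
  \<open>q \<mapsto> \<omega> q\<close>, so neither do the denominators nor the constant, and the filter isolates
  the terms with \<open>b n \<equiv> r\<close>. As \<open>b\<close> is invertible modulo \<open>M\<close>, these are the terms with \<open>n \<equiv> n0\<close>,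
  whose sum is zero.
\<close>
theorem theta_quotient_coefficients_vanish:
  fixes a :: "nat \<Rightarrow> complex"
  assumes b: "0 < b" "b < M" and cop: "coprime b M" and M: "b + 2 * n0 + 1 = 2 * M"
      and r: "[b * n0 = r] (mod M)"
      and a: "\<And>q :: complex. norm q < 1 \<Longrightarrow>
        (\<lambda>n. a n * q ^ n) sums (qpoch_inf2 (q ^ (M - b)) (q ^ (M + b)) (q ^ (2 * M)) /
          qpoch_inf2 (q ^ b) (q ^ (2 * M - b)) (q ^ (2 * M)))"
  shows "a (M * n + r) = 0"
proof -
  define A where "A = (\<lambda>q :: complex. qpoch_inf2 (q ^ (M - b)) (q ^ (M + b)) (q ^ (2 * M)) /
          qpoch_inf2 (q ^ b) (q ^ (2 * M - b)) (q ^ (2 * M)))"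
  define \<omega> where "\<omega> = cis (2 * pi / real M)"
  have M0: "M > 0" using b by simp
  have \<omega>: "\<omega> \<noteq> 0" "norm \<omega> = 1" by (simp_all add: \<omega>_def)
  have \<omega>M: "(\<omega> ^ k) ^ M = 1" for k
  proof -
    have "\<omega> ^ M = 1" using M0 by (simp add: \<omega>_def Complex.DeMoivre)
    moreover have "(\<omega> ^ k) ^ M = (\<omega> ^ M) ^ k"
      by (simp only: power_mult[symmetric] mult.commute)
    ultimately show ?thesis by simp
  qed
  define B where "B = (\<lambda>q. \<Sum>k<M. \<omega> powi (- int k * int r) * A (\<omega> ^ k * q))"
  define g where "g = (\<lambda>n. a n * (if int M dvd int n - int r then of_nat M else 0))"
  have filter: "(\<Sum>k<M. \<omega> powi (- int k * int r) * (c * (\<omega> ^ k) powi j)) = c * (if int M dvd j - int r then of_nat M else 0)"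
    for c and j :: int
  proof -
    have "\<omega> powi (- int k * int r) * (c * (\<omega> ^ k) powi j) = c * \<omega> powi (int k * (j - int r))" for k
    proof -
      have "int k * (j - int r) = - int k * int r + int k * j" by (simp add: algebra_simps)
      moreover have "\<omega> powi (- int k * int r + int k * j) = \<omega> powi (- int k * int r) * \<omega> powi (int k * j)"
        using \<omega>(1) by (intro power_int_add) simp
      ultimately show ?thesis
        by (simp only: power_int_power mult.left_commute)
    qed
    then have "(\<Sum>k<M. \<omega> powi (- int k * int r) * (c * (\<omega> ^ k) powi j)) = c * (\<Sum>k<M. \<omega> powi (int k * (j - int r)))"
      by (simp only: sum_distrib_left)
    then show ?thesis
      using sum_root_of_unity_powers[OF M0, of "j - int r"] by (simp only: \<omega>_def)
  qed
  have g: "(\<lambda>n. g n * q ^ n) sums B q" if q: "norm q < 1" for q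
  proof -
    have "(\<lambda>n. \<Sum>k<M. \<omega> powi (- int k * int r) * (a n * (\<omega> ^ k * q) ^ n)) sums B q"
      unfolding B_def A_def using q \<omega> by (intro sums_sum sums_mult a) (simp add: norm_mult norm_power)
    also have "(\<lambda>n. \<Sum>k<M. \<omega> powi (- int k * int r) * (a n * (\<omega> ^ k * q) ^ n)) = (\<lambda>n. g n * q ^ n)"
    proof
      fix n
      show "(\<Sum>k<M. \<omega> powi (- int k * int r) * (a n * (\<omega> ^ k * q) ^ n)) = g n * q ^ n"
        using filter[of "a n * q ^ n" "int n"] by (simp add: g_def power_mult_distrib mult_ac)
    qed
    finally show ?thesis .
  qed
  \<comment> \<open>Real q is used here because the constant is known to be nonzero for real nome only.\<close>
  have "B (of_real x) = 0" if x: "0 < x" "x < 1" for x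
  proof -
    define q where "q = complex_of_real x"
    define p where "p = q ^ M"
    define T where "T = lambert_theta_coeff p 0"
    have q: "q \<noteq> 0" "norm q = x" using x by (auto simp: q_def)
    have p: "p \<noteq> 0" "norm p < 1"
      using q x M0 by (auto simp: p_def norm_power power_less_one_iff)
    have "(0 :: real) < x ^ M" "x ^ M < 1" using x M0 by (auto simp: power_less_one_iff)
    from lambert_theta_coeff_nonzero[OF this] have T: "T \<noteq> 0"
      by (simp add: T_def p_def q_def)
    have rotated: "(lambert_term p ((\<omega> ^ k * q) ^ b) has_sum (T * A (\<omega> ^ k * q))) UNIV" for k
    proof -
      define y where "y = \<omega> ^ k * q"
      have y: "y \<noteq> 0" "norm y = x" using \<omega> q by (auto simp: y_def norm_mult norm_power)
      have yM: "y ^ M = p" using \<omega>M[of k] by (simp add: y_def power_mult_distrib p_def)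
      have "norm p ^ 2 = x ^ (2 * M)"
        by (simp add: p_def norm_power q power_mult[symmetric] mult.commute)
      also have "\<dots> < x ^ b" using x b by (intro power_strict_decreasing) auto
      finally have "norm p ^ 2 < norm (y ^ b)" by (simp add: norm_power y)
      moreover have "norm (y ^ b) < 1" using x b by (simp add: norm_power y power_less_one_iff)
      ultimately have "(lambert_term p (y ^ b) has_sum
           (T * (qpoch_inf2 (p / y ^ b) (p * y ^ b) (p^2) / qpoch_inf2 (y ^ b) (p^2 / y ^ b) (p^2)))) UNIV"
        unfolding T_def by (rule lambert_series_eq_theta_quotient[OF p])
      moreover have "p / y ^ b = y ^ (M - b)" "p * y ^ b = y ^ (M + b)"
          "p^2 = y ^ (2 * M)" "y ^ (2 * M) / y ^ b = y ^ (2 * M - b)"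
        using y b by (auto simp: yM[symmetric] power_diff power_add power_mult[symmetric] mult.commute)
      ultimately show ?thesis by (simp add: A_def y_def)
    qed
    have "((\<lambda>n. \<Sum>k<M. \<omega> powi (- int k * int r) * lambert_term p ((\<omega> ^ k * q) ^ b) n)
        has_sum (\<Sum>k<M. \<omega> powi (- int k * int r) * (T * A (\<omega> ^ k * q)))) UNIV"
      by (intro has_sum_finite_sum finite_lessThan has_sum_cmult_right rotated)
    also have "(\<Sum>k<M. \<omega> powi (- int k * int r) * (T * A (\<omega> ^ k * q))) = T * B q"
      by (simp add: B_def sum_distrib_left mult_ac)
    also have "(\<lambda>n. \<Sum>k<M. \<omega> powi (- int k * int r) * lambert_term p ((\<omega> ^ k * q) ^ b) n) =
       (\<lambda>n. lambert_term p (q ^ b) n * (if [n = int n0] (mod int M) then of_nat M else 0))"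
    proof
      fix n
      have cong: "int M dvd int b * n - int r \<longleftrightarrow> [n = int n0] (mod int M)"
      proof -
        have "[int b * int n0 = int r] (mod int M)"
          using r by (metis cong_int_iff of_nat_mult)
        then have "[int b * n = int r] (mod int M) \<longleftrightarrow> [int b * n = int b * int n0] (mod int M)"
          using cong_sym cong_trans by blast
        also have "\<dots> \<longleftrightarrow> [n = int n0] (mod int M)"
          using cop by (intro cong_mult_lcancel) simp
        finally show ?thesis by (simp add: cong_iff_dvd_diff)
      qed
      have "lambert_term p ((\<omega> ^ k * q) ^ b) n = lambert_term p (q ^ b) n * (\<omega> ^ k) powi (int b * n)" for k
        by (simp add: lambert_term_def power_mult_distrib power_int_mult_distrib power_int_mult)
      then show "(\<Sum>k<M. \<omega> powi (- int k * int r) * lambert_term p ((\<omega> ^ k * q) ^ b) n) =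
         lambert_term p (q ^ b) n * (if [n = int n0] (mod int M) then of_nat M else 0)"
        using filter[of "lambert_term p (q ^ b) n" "int b * n"] cong by simp
    qed
    finally have "((\<lambda>n. lambert_term p (q ^ b) n * (if [n = int n0] (mod int M) then of_nat M else 0)) has_sum T * B q) UNIV" .
    moreover have "((\<lambda>n. lambert_term p (q ^ b) n * (if [n = int n0] (mod int M) then of_nat M else 0)) has_sum 0 * of_nat M) UNIV"
    proof (subst has_sum_cong_neutral)
      show "((\<lambda>n. lambert_term p (q ^ b) n * of_nat M) has_sum 0 * of_nat M) {n. [n = int n0] (mod int M)}"
        using lambert_term_progression_has_sum_0[of q b n0 M] q x M b
        by (intro has_sum_cmult_left) (simp add: p_def)
    qed auto
    ultimately have "T * B q = 0"
      using has_sum_unique by fastforce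
    then show ?thesis using T by (simp add: q_def)
  qed
  from powser_zero_on_unit_interval[OF g this] have "g (M * n + r) = 0" by simp
  then show ?thesis using M0 by (simp add: g_def)
qed

theorem theorem2p3:
  fixes a b c d :: "nat \<Rightarrow> complex"
  assumes a: "\<And>q :: complex. norm q < 1 \<Longrightarrow>
      (\<lambda>n. a n * q ^ n) sums (qpoch_inf2 (q ^ 8) (q ^ 22) (q ^ 30) / qpoch_inf2 (q ^ 7) (q ^ 23) (q ^ 30))"
    and b: "\<And>q :: complex. norm q < 1 \<Longrightarrow>
      (\<lambda>n. b n * q ^ n) sums (qpoch_inf2 (q ^ 4) (q ^ 26) (q ^ 30) / qpoch_inf2 (q ^ 11) (q ^ 19) (q ^ 30))"
    and c: "\<And>q :: complex. norm q < 1 \<Longrightarrow>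
      (\<lambda>n. c n * q ^ n) sums (qpoch_inf2 (q ^ 2) (q ^ 28) (q ^ 30) / qpoch_inf2 (q ^ 13) (q ^ 17) (q ^ 30))"
    and d: "\<And>q :: complex. norm q < 1 \<Longrightarrow>
      (\<lambda>n. d n * q ^ n) sums (qpoch_inf2 (q ^ 14) (q ^ 16) (q ^ 30) / qpoch_inf2 q (q ^ 29) (q ^ 30))"
  shows "\<forall>n. a (15 * n + 2) = 0 \<and> b (15 * n + 9) = 0 \<and> c (15 * n + 14) = 0 \<and> d (15 * n + 14) = 0"
proof (intro allI conjI)
  fix n
  \<comment> \<open>In each case n0 = (29 - b) / 2, and the residue is b * n0 modulo 15.\<close>
  have cop: "coprime (7 :: nat) 15" "coprime (11 :: nat) 15" "coprime (13 :: nat) 15"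
    by (simp_all add: coprime_iff_gcd_eq_1 gcd_non_0_nat)
  show "a (15 * n + 2) = 0"
    by (rule theta_quotient_coefficients_vanish[of 7 15 11 2 a n]) (simp_all add: cong_def cop a)
  show "b (15 * n + 9) = 0"
    by (rule theta_quotient_coefficients_vanish[of 11 15 9 9 b n]) (simp_all add: cong_def cop b)
  show "c (15 * n + 14) = 0"
    by (rule theta_quotient_coefficients_vanish[of 13 15 8 14 c n]) (simp_all add: cong_def cop c)
  show "d (15 * n + 14) = 0"
    by (rule theta_quotient_coefficients_vanish[of 1 15 14 14 d n]) (simp_all add: cong_def d)
qed

end
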